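(* Let $R$ be a commutative ring with the property that every purely-maximal ideal of $R$ is finitely generated. Then the following hold. (i) The pure ideals of $R$ are exactly the ideals of the form $Re$ where $e$ is an idempotent of $R$. In particular, every purely-prime ideal of $R$ is purely-maximal. (ii) The purely-prime ideals of $R$ are exactly the ideals of the form $R(1-e)$ where $e$ is a primitive idempotent of $R$.
   Context: Rings are commutative with identity. An ideal $I$ of a ring $R$ is called a pure ideal if $R/I$ is a flat $R$-module, or equivalently, if for each $a\in I$ there exists some $b\in I$ such that $a(1-b)=0$. The zero ideal and $R$ itself are always pure. A purely-prime ideal of $R$ is a proper pure ideal $I$ of $R$ such that whenever $J$ and $J'$ are pure ideals of $R$ with $JJ'\subseteq I$, then $J\subseteq I$ or $J'\subseteq I$. A purely-maximal ideal of $R$ is a proper pure ideal of $R$ that is a maximal element (with respect to inclusion) of the set of proper pure ideals of $R$. A primitive idempotent of $R$ is a nonzero idempotent $e\in R$ such that if $ee'=e'$ for some nonzero idempotent $e'\in R$, then $e=e'$. *)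

theory Defs
  imports "HOL-Algebra.Algebra"
begin

text \<open>An ideal \<open>I\<close> of a commutative ring \<open>R\<close> is pure if the module \<open>R/I\<close> is flat. HOL-Algebra
  provides neither tensor products nor flatness, so the standard equivalent condition on elements
  is taken as the definition: for each \<open>a \<in> I\<close> there is \<open>b \<in> I\<close> with \<open>a(1 - b) = 0\<close>.\<close>

definition pure_ideal :: "'a set \<Rightarrow> ('a, 'b) ring_scheme \<Rightarrow> bool" where
  "pure_ideal I R \<longleftrightarrow>
     ideal I R \<and> (\<forall>a\<in>I. \<exists>b\<in>I. a \<otimes>\<^bsub>R\<^esub> (\<one>\<^bsub>R\<^esub> \<ominus>\<^bsub>R\<^esub> b) = \<zero>\<^bsub>R\<^esub>)"

definition purely_prime_ideal :: "'a set \<Rightarrow> ('a, 'b) ring_scheme \<Rightarrow> bool" where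
  "purely_prime_ideal I R \<longleftrightarrow>
     pure_ideal I R \<and> I \<noteq> carrier R \<and>
     (\<forall>J J'. pure_ideal J R \<longrightarrow> pure_ideal J' R \<longrightarrow> J \<cdot>\<^bsub>R\<^esub> J' \<subseteq> I \<longrightarrow> J \<subseteq> I \<or> J' \<subseteq> I)"

definition purely_maximal_ideal :: "'a set \<Rightarrow> ('a, 'b) ring_scheme \<Rightarrow> bool" where
  "purely_maximal_ideal I R \<longleftrightarrow>
     pure_ideal I R \<and> I \<noteq> carrier R \<and>
     (\<forall>J. pure_ideal J R \<longrightarrow> J \<noteq> carrier R \<longrightarrow> I \<subseteq> J \<longrightarrow> J = I)"

definition fin_gen_ideal :: "'a set \<Rightarrow> ('a, 'b) ring_scheme \<Rightarrow> bool" where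
  "fin_gen_ideal I R \<longleftrightarrow> (\<exists>A\<subseteq>carrier R. finite A \<and> I = Idl\<^bsub>R\<^esub> A)"

definition idempotent_elem :: "('a, 'b) ring_scheme \<Rightarrow> 'a \<Rightarrow> bool" where
  "idempotent_elem R e \<longleftrightarrow> e \<in> carrier R \<and> e \<otimes>\<^bsub>R\<^esub> e = e"

definition primitive_idempotent :: "('a, 'b) ring_scheme \<Rightarrow> 'a \<Rightarrow> bool" where
  "primitive_idempotent R e \<longleftrightarrow>
     idempotent_elem R e \<and> e \<noteq> \<zero>\<^bsub>R\<^esub> \<and>
     (\<forall>e'. idempotent_elem R e' \<longrightarrow> e' \<noteq> \<zero>\<^bsub>R\<^esub> \<longrightarrow> e \<otimes>\<^bsub>R\<^esub> e' = e' \<longrightarrow> e = e')"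

end

theory Submission
  imports Defs
begin

text \<open>A finitely generated pure ideal is generated by an idempotent: if \<open>a\<^sub>i(1 - b\<^sub>i) = 0\<close> for the
  generators \<open>a\<^sub>i\<close>, then the element \<open>b\<close> with \<open>1 - b = \<Prod>(1 - b\<^sub>i)\<close> lies in the ideal and acts on it
  as the identity. For an arbitrary pure ideal \<open>I\<close>, the elements \<open>x\<close> with \<open>xe \<in> I\<close> for some
  idempotent \<open>e\<close> acting as the identity on \<open>I\<close> form a pure ideal \<open>J \<supseteq> I\<close>. If \<open>J\<close> were proper, Zorn's
  lemma would place it in a purely-maximal ideal, by hypothesis of the form \<open>Rf\<close> with \<open>f\<close> idempotent;
  but \<open>f\<close> acts as the identity on \<open>I\<close> and \<open>(1 - f)f = 0 \<in> I\<close>, so \<open>1 - f \<in> J \<subseteq> Rf\<close>, which forces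
  \<open>Rf = R\<close>. Hence \<open>1 \<in> J\<close>, that is, \<open>I\<close> contains an idempotent acting as the identity on \<open>I\<close>. Once all
  pure ideals are generated by idempotents, the statements on purely-prime ideals follow by
  computing with idempotents, mainly from \<open>f(1 - f) = 0\<close>.\<close>

context cring
begin

section \<open>Purity and idempotents as equations between elements\<close>

lemma mult_one_minus_eq_zero_iff:
  assumes "a \<in> carrier R" "b \<in> carrier R"
  shows "a \<otimes> (\<one> \<ominus> b) = \<zero> \<longleftrightarrow> a \<otimes> b = a"
proof -
  have "a \<otimes> (\<one> \<ominus> b) = a \<ominus> a \<otimes> b"
    using assms by (simp add: minus_eq r_distr r_minus)
  then show ?thesis
    using assms by (metis m_closed r_right_minus_eq)
qed

lemma pure_ideal_iff:
  "pure_ideal I R \<longleftrightarrow> ideal I R \<and> (\<forall>a\<in>I. \<exists>b\<in>I. a \<otimes> b = a)"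
  unfolding pure_ideal_def
  by (meson ideal.Icarr mult_one_minus_eq_zero_iff)

lemma pure_ideal_eq_carrier_iff: "pure_ideal I R \<Longrightarrow> I = carrier R \<longleftrightarrow> \<one> \<in> I"
  unfolding pure_ideal_def by (metis ideal.one_imp_carrier one_closed)

lemma idempotent_elem_closed: "idempotent_elem R e \<Longrightarrow> e \<in> carrier R"
  by (simp add: idempotent_elem_def)

lemma one_minus_mult_idempotent:
  assumes "idempotent_elem R e"
  shows "(\<one> \<ominus> e) \<otimes> e = \<zero>"
proof -
  have e: "e \<in> carrier R" "e \<otimes> e = e"
    using assms by (auto simp: idempotent_elem_def)
  then have "e \<otimes> (\<one> \<ominus> e) = \<zero>"
    by (simp add: mult_one_minus_eq_zero_iff)
  then show ?thesis
    using e by (simp add: m_comm)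
qed

lemma idempotent_elem_one_minus:
  assumes "idempotent_elem R e"
  shows "idempotent_elem R (\<one> \<ominus> e)"
proof -
  have e: "e \<in> carrier R"
    using assms by (rule idempotent_elem_closed)
  moreover have "(\<one> \<ominus> e) \<otimes> (\<one> \<ominus> e) = (\<one> \<ominus> e) \<ominus> (\<one> \<ominus> e) \<otimes> e"
    using e by (simp add: minus_eq r_distr r_minus)
  ultimately show ?thesis
    using one_minus_mult_idempotent [OF assms] by (simp add: idempotent_elem_def minus_eq)
qed

lemma one_minus_one_minus: "e \<in> carrier R \<Longrightarrow> \<one> \<ominus> (\<one> \<ominus> e) = e"
  by (simp add: minus_eq minus_add a_assoc [symmetric] r_neg)

lemma idempotent_elem_mult:
  assumes "idempotent_elem R e" "idempotent_elem R f"
  shows "idempotent_elem R (e \<otimes> f)"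
proof -
  have e: "e \<in> carrier R" "e \<otimes> e = e" and f: "f \<in> carrier R" "f \<otimes> f = f"
    using assms by (auto simp: idempotent_elem_def)
  have "(e \<otimes> f) \<otimes> (e \<otimes> f) = (e \<otimes> e) \<otimes> (f \<otimes> f)"
    using e(1) f(1) by (simp add: m_ac)
  then show ?thesis
    using e f by (simp add: idempotent_elem_def)
qed

text \<open>Multiplication by \<open>e\<close> is a projection onto \<open>PIdl e\<close>, so
  membership becomes a fixed-point equation. Together with the annihilator form for
  \<open>\<one> \<ominus> e\<close> below, this reduces ideal containments to computations with
  elements.\<close>

lemma mem_cgenideal_idempotent_iff:
  assumes "idempotent_elem R e"
  shows "x \<in> PIdl e \<longleftrightarrow> x \<in> carrier R \<and> x \<otimes> e = x"
proof
  assume "x \<in> PIdl e"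
  then obtain r where "r \<in> carrier R" "x = r \<otimes> e"
    by (auto simp: cgenideal_def)
  with assms show "x \<in> carrier R \<and> x \<otimes> e = x"
    by (simp add: idempotent_elem_def m_assoc)
next
  assume "x \<in> carrier R \<and> x \<otimes> e = x"
  then show "x \<in> PIdl e"
    unfolding cgenideal_def by force
qed

lemma mem_cgenideal_one_minus_iff:
  assumes "idempotent_elem R e"
  shows "x \<in> PIdl (\<one> \<ominus> e) \<longleftrightarrow> x \<in> carrier R \<and> x \<otimes> e = \<zero>"
proof -
  note e = idempotent_elem_closed [OF assms]
  then show ?thesis
    using mult_one_minus_eq_zero_iff [of x "\<one> \<ominus> e"]
    by (auto simp: mem_cgenideal_idempotent_iff idempotent_elem_one_minus assms one_minus_one_minus)
qed

lemma pure_ideal_cgenideal: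
  assumes "idempotent_elem R e"
  shows "pure_ideal (PIdl e) R"
  unfolding pure_ideal_iff
  using assms idempotent_elem_closed [OF assms] cgenideal_ideal cgenideal_self
  by (metis mem_cgenideal_idempotent_iff)

text \<open>As \<open>e\<close> lies in \<open>I\<close>, it also fixes itself, which is
  idempotency.\<close>

lemma ideal_eq_cgenideal_idempotent:
  assumes "ideal I R" "e \<in> I" "\<And>x. x \<in> I \<Longrightarrow> x \<otimes> e = x"
  shows "idempotent_elem R e \<and> I = PIdl e"
proof
  have "e \<in> carrier R"
    using assms(1,2) by (rule ideal.Icarr)
  then show "idempotent_elem R e"
    using assms(2,3) by (simp add: idempotent_elem_def)
  then have "I \<subseteq> PIdl e"
    using assms(3) ideal.Icarr [OF assms(1)] by (auto simp: mem_cgenideal_idempotent_iff)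
  then show "I = PIdl e"
    using cgenideal_minimal [OF assms(1,2)] by (rule subset_antisym)
qed

section \<open>Finitely generated pure ideals\<close>

lemma pure_ideal_finite_subset:
  assumes "pure_ideal I R" "finite A" "A \<subseteq> I"
  shows "\<exists>b\<in>I. \<forall>a\<in>A. a \<otimes> b = a"
  using assms(2,3)
proof (induction A)
  case empty
  interpret ideal I R using assms(1) by (simp add: pure_ideal_def)
  show ?case using zero_closed by blast
next
  case (insert x A)
  interpret ideal I R using assms(1) by (simp add: pure_ideal_def)
  from insert obtain b where b: "b \<in> I" "\<forall>a\<in>A. a \<otimes> b = a" by auto
  from insert assms(1) obtain c where c: "c \<in> I" "x \<otimes> c = x"
    by (auto simp: pure_ideal_iff)
  note carr = Icarr [OF b(1)] Icarr [OF c(1)]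
  \<comment> \<open>\<open>1 - d = (1 - b)(1 - c)\<close>\<close>
  define d where "d = b \<oplus> c \<ominus> b \<otimes> c"
  have eq: "a \<otimes> d = a \<otimes> b \<oplus> a \<otimes> c \<ominus> (a \<otimes> b) \<otimes> c" if "a \<in> carrier R" for a
    using that carr by (simp add: d_def minus_eq r_distr r_minus m_assoc)
  have "a \<otimes> d = a" if "a \<in> carrier R" "a \<otimes> b = a" for a
    using that carr by (simp add: eq minus_eq a_assoc r_neg)
  moreover have "a \<otimes> d = a" if "a \<in> carrier R" "a \<otimes> c = a" for a
  proof -
    \<comment> \<open>Multiplication by \<open>c\<close> fixes every multiple of \<open>a\<close>,
      hence \<open>a \<otimes> b\<close>.\<close>
    have "(a \<otimes> b) \<otimes> c = a \<otimes> b"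
      using that carr by (metis m_assoc m_comm)
    then have "a \<otimes> d = a \<otimes> b \<oplus> a \<ominus> a \<otimes> b"
      using that by (simp add: eq)
    also have "\<dots> = a"
      using that carr by (simp add: minus_eq a_comm [of "a \<otimes> b" a] a_assoc r_neg)
    finally show ?thesis .
  qed
  moreover have "d \<in> I"
    using b(1) c(1) carr by (simp add: d_def minus_eq I_l_closed)
  ultimately show ?case
    using b c insert.prems Icarr by (metis insertE insert_subset subsetD)
qed

lemma fin_gen_pure_ideal:
  assumes "pure_ideal I R" "fin_gen_ideal I R"
  shows "\<exists>e. idempotent_elem R e \<and> I = PIdl e"
proof -
  have I: "ideal I R" using assms(1) by (simp add: pure_ideal_def)
  obtain A where A: "A \<subseteq> carrier R" "finite A" "I = Idl A"
    using assms(2) by (auto simp: fin_gen_ideal_def)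
  obtain e where e: "e \<in> I" "\<forall>a\<in>A. a \<otimes> e = a"
    using pure_ideal_finite_subset [OF assms(1) A(2)] A(1,3) genideal_self by blast
  have ec: "e \<in> carrier R" using ideal.Icarr [OF I e(1)] .
  \<comment> \<open>The fixed elements of \<open>e\<close> form an ideal, so \<open>e\<close> fixes
    all of \<open>I\<close> as soon as it fixes the generators.\<close>
  have "ideal {x \<in> carrier R. x \<otimes> e = x} R" (is "ideal ?K R")
  proof (rule idealI)
    show "subgroup ?K (add_monoid R)"
      by (rule group.subgroupI [OF a_group])
        (use ec l_null in \<open>auto simp: l_distr a_inv_def [symmetric] l_minus\<close>)
    show "x \<otimes> a \<in> ?K" if "a \<in> ?K" "x \<in> carrier R" for a x
      using that ec by (simp add: m_assoc)
    then show "a \<otimes> x \<in> ?K" if "a \<in> ?K" "x \<in> carrier R" for a x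
      using that by (metis (lifting) m_comm mem_Collect_eq)
  qed (rule ring_axioms)
  then have "I \<subseteq> ?K"
    unfolding A(3) by (rule genideal_minimal) (use A(1) e(2) in blast)
  then show ?thesis
    using ideal_eq_cgenideal_idempotent [OF I e(1)] by blast
qed

section \<open>Existence of purely-maximal ideals\<close>

text \<open>The purity witness of an element can be taken in the same member of the chain, so it
  survives in the union.\<close>

lemma pure_ideal_Union_chain:
  assumes "\<C> \<noteq> {}" "subset.chain {I. pure_ideal I R} \<C>"
  shows "pure_ideal (\<Union>\<C>) R"
proof -
  have "subset.chain {I. ideal I R} \<C>"
    using assms(2) by (auto simp: subset_chain_def pure_ideal_def)
  then have "ideal (\<Union>\<C>) R"
    using ring.chain_Union_is_ideal [OF ring_axioms, of \<C>] assms(1) by simp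
  then show ?thesis
    using assms(2) unfolding pure_ideal_iff subset_chain_def by blast
qed

lemma pure_ideal_le_purely_maximal:
  assumes "pure_ideal I R" "I \<noteq> carrier R"
  shows "\<exists>M. purely_maximal_ideal M R \<and> I \<subseteq> M"
proof -
  let ?S = "{J. pure_ideal J R \<and> J \<noteq> carrier R \<and> I \<subseteq> J}"
  have chain: "\<Union>\<C> \<in> ?S" if "\<C> \<noteq> {}" "subset.chain ?S \<C>" for \<C>
  proof -
    have *: "pure_ideal (\<Union>\<C>) R"
      using that by (intro pure_ideal_Union_chain) (auto simp: subset_chain_def)
    \<comment> \<open>Being proper means omitting \<open>\<one>\<close>, a condition that passes to
      unions.\<close>
    have "\<one> \<notin> \<Union>\<C>"
      using that(2) pure_ideal_eq_carrier_iff by (auto simp: subset_chain_def)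
    then have "\<Union>\<C> \<noteq> carrier R"
      using one_closed by metis
    moreover have "I \<subseteq> \<Union>\<C>"
      using that unfolding subset_chain_def by blast
    ultimately show ?thesis
      using * by blast
  qed
  have "?S \<noteq> {}"
    using assms by blast
  then have "\<exists>M\<in>?S. \<forall>J\<in>?S. M \<subseteq> J \<longrightarrow> J = M"
    using chain by (rule subset_Zorn_nonempty)
  then obtain M where "M \<in> ?S" "\<forall>J\<in>?S. M \<subseteq> J \<longrightarrow> J = M" ..
  then have "purely_maximal_ideal M R \<and> I \<subseteq> M"
    unfolding purely_maximal_ideal_def by blast
  then show ?thesis by blast
qed

section \<open>Arbitrary pure ideals\<close>

lemma pure_ideal_idempotent_multiplier:
  assumes "pure_ideal I R"
  shows "pure_ideal
    {x \<in> carrier R. \<exists>e. idempotent_elem R e \<and> (\<forall>i\<in>I. i \<otimes> e = i) \<and> x \<otimes> e \<in> I} R"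
    (is "pure_ideal ?J R")
proof -
  interpret I: ideal I R using assms by (simp add: pure_ideal_def)
  have add: "x \<oplus> y \<in> ?J" if "x \<in> ?J" "y \<in> ?J" for x y
  proof -
    from that obtain e f
      where e: "idempotent_elem R e" "\<forall>i\<in>I. i \<otimes> e = i" "x \<otimes> e \<in> I"
        and f: "idempotent_elem R f" "\<forall>i\<in>I. i \<otimes> f = i" "y \<otimes> f \<in> I"
      by blast
    have carr: "x \<in> carrier R" "y \<in> carrier R" "e \<in> carrier R" "f \<in> carrier R"
      using that e(1) f(1) by (auto simp: idempotent_elem_def)
    \<comment> \<open>The product \<open>e \<otimes> f\<close> serves both summands: it is
      idempotent and still acts as the identity on \<open>I\<close>.\<close>
    have "(x \<oplus> y) \<otimes> (e \<otimes> f) = (x \<otimes> e) \<otimes> f \<oplus> (y \<otimes> f) \<otimes> e"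
      using carr by (simp add: l_distr r_distr m_ac)
    also have "\<dots> \<in> I"
      using e(3) f(3) carr by (simp add: I.I_r_closed)
    finally show ?thesis
      using carr idempotent_elem_mult [OF e(1) f(1)] e(2) f(2)
      by (auto intro!: exI [of _ "e \<otimes> f"] simp: m_assoc [symmetric] I.Icarr)
  qed
  have mult: "r \<otimes> x \<in> ?J" if x: "x \<in> ?J" and r: "r \<in> carrier R" for x r
  proof -
    from x obtain e
      where e: "idempotent_elem R e" "\<forall>i\<in>I. i \<otimes> e = i" "x \<otimes> e \<in> I"
      by blast
    have "r \<otimes> x \<otimes> e = r \<otimes> (x \<otimes> e)"
      using x r e(1) by (simp add: idempotent_elem_def m_assoc)
    also have "\<dots> \<in> I"
      using e(3) r by (rule I.I_l_closed)
    finally show ?thesis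
      using x r e by blast
  qed
  have zero: "\<zero> \<in> ?J"
    using I.Icarr by (auto intro!: exI [of _ \<one>] simp: idempotent_elem_def)
  have neg: "\<ominus> x \<in> ?J" if "x \<in> ?J" for x
    using mult [OF that, of "\<ominus> \<one>"] that by (simp add: l_minus)
  have "ideal ?J R"
  proof (rule idealI)
    show "subgroup ?J (add_monoid R)"
      by (rule group.subgroupI [OF a_group])
        (use zero add neg in \<open>auto simp: a_inv_def [symmetric]\<close>)
    show "x \<otimes> a \<in> ?J" "a \<otimes> x \<in> ?J" if "a \<in> ?J" "x \<in> carrier R" for a x
      using mult [OF that] that by (simp_all add: m_comm)
  qed (rule ring_axioms)
  moreover have "\<exists>c\<in>?J. x \<otimes> c = x" if x: "x \<in> ?J" for x
  proof -
    from x obtain e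
      where e: "idempotent_elem R e" "\<forall>i\<in>I. i \<otimes> e = i" "x \<otimes> e \<in> I"
      by blast
    obtain b where b: "b \<in> I" "(x \<otimes> e) \<otimes> b = x \<otimes> e"
      using assms e(3) by (auto simp: pure_ideal_iff)
    have carr: "x \<in> carrier R" "e \<in> carrier R" "b \<in> carrier R"
      using x e(1) b(1) I.Icarr by (auto simp: idempotent_elem_def)
    have be: "b \<otimes> e = b" using e(2) b(1) by blast
    have xb: "x \<otimes> b = x \<otimes> e"
      using b(2) be carr by (metis m_assoc m_comm)
    \<comment> \<open>\<open>1 - c = e(1 - b)\<close>\<close>
    define c where "c = (\<one> \<ominus> e) \<oplus> b"
    have "(\<one> \<ominus> e) \<otimes> e = \<zero>"
      using e(1) by (rule one_minus_mult_idempotent)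
    \<comment> \<open>The idempotent \<open>e\<close> that puts \<open>x\<close> into
      \<open>?J\<close> therefore puts \<open>c\<close> there too.\<close>
    then have "c \<otimes> e = b"
      using carr be by (simp add: c_def l_distr)
    then have "c \<in> ?J"
      using e b(1) carr by (auto simp: c_def)
    moreover have "x \<otimes> c = x"
      using carr xb by (simp add: c_def minus_eq r_distr r_minus a_assoc l_neg)
    ultimately show ?thesis by blast
  qed
  ultimately show ?thesis
    unfolding pure_ideal_iff by blast
qed

lemma pure_ideal_generated_by_idempotent:
  assumes fg: "\<And>M. purely_maximal_ideal M R \<Longrightarrow> fin_gen_ideal M R"
    and I: "pure_ideal I R"
  shows "\<exists>e. idempotent_elem R e \<and> I = PIdl e"
proof -
  interpret I: ideal I R using I by (simp add: pure_ideal_def)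
  let ?J = "{x \<in> carrier R. \<exists>e. idempotent_elem R e \<and> (\<forall>i\<in>I. i \<otimes> e = i) \<and> x \<otimes> e \<in> I}"
  have IJ: "I \<subseteq> ?J"
    by (auto intro!: exI [of _ \<one>] simp: idempotent_elem_def I.Icarr)
  have "?J = carrier R"
  proof (rule ccontr)
    assume "?J \<noteq> carrier R"
    then obtain M where M: "purely_maximal_ideal M R" and JM: "?J \<subseteq> M"
      using pure_ideal_le_purely_maximal [OF pure_ideal_idempotent_multiplier [OF I]] by blast
    have "pure_ideal M R" "M \<noteq> carrier R"
      using M by (auto simp: purely_maximal_ideal_def)
    then obtain f where f: "idempotent_elem R f" and Mf: "M = PIdl f"
      using fin_gen_pure_ideal fg [OF M] by blast
    note fc = idempotent_elem_closed [OF f]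
    have zero: "(\<one> \<ominus> f) \<otimes> f = \<zero>"
      using f by (rule one_minus_mult_idempotent)
    have "\<forall>i\<in>I. i \<otimes> f = i"
      using IJ JM Mf mem_cgenideal_idempotent_iff [OF f] by blast
    then have "\<one> \<ominus> f \<in> ?J"
      using f fc zero by auto
    then have "\<one> \<ominus> f \<in> PIdl f"
      using JM Mf by blast
    \<comment> \<open>Membership in \<open>PIdl f\<close> says that \<open>f\<close> fixes
      \<open>\<one> \<ominus> f\<close>, yet their product is zero.\<close>
    then have "\<one> \<ominus> f = \<zero>"
      using zero mem_cgenideal_idempotent_iff [OF f] by simp
    then have "\<one> = f"
      using fc by simp
    then have "\<one> \<in> M"
      using Mf cgenideal_self by blast
    then show False
      using \<open>pure_ideal M R\<close> \<open>M \<noteq> carrier R\<close> pure_ideal_eq_carrier_iff by blast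
  qed
  then have "\<one> \<in> ?J" by blast
  \<comment> \<open>For \<open>x = \<one>\<close>, the condition
    \<open>x \<otimes> e \<in> I\<close> defining \<open>?J\<close> becomes
    \<open>e \<in> I\<close>.\<close>
  then obtain e where e: "idempotent_elem R e" "\<forall>i\<in>I. i \<otimes> e = i" "e \<in> I"
    by (auto simp: idempotent_elem_def)
  then show ?thesis
    using ideal_eq_cgenideal_idempotent [OF I.ideal_axioms] by blast
qed

section \<open>Purely-prime ideals and primitive idempotents\<close>

text \<open>The pure ideals generated by \<open>f\<close> and \<open>\<one> \<ominus> f\<close> have
  product zero, so \<open>P\<close> contains one of them.\<close>

lemma purely_prime_idempotent_cases:
  assumes "purely_prime_ideal P R" "idempotent_elem R f"
  shows "f \<in> P \<or> \<one> \<ominus> f \<in> P"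
proof -
  note f = assms(2) and fc = idempotent_elem_closed [OF assms(2)]
  interpret P: ideal P R
    using assms(1) by (simp add: purely_prime_ideal_def pure_ideal_def)
  have "(PIdl f) \<cdot> (PIdl (\<one> \<ominus> f)) \<subseteq> P"
  proof
    fix s assume "s \<in> (PIdl f) \<cdot> (PIdl (\<one> \<ominus> f))"
    then show "s \<in> P"
    proof (induction s rule: ideal_prod.induct)
      case (prod i j)
      then have i: "i \<in> carrier R" "i \<otimes> f = i" and j: "j \<in> carrier R" "j \<otimes> f = \<zero>"
        by (auto simp: mem_cgenideal_idempotent_iff [OF f] mem_cgenideal_one_minus_iff [OF f])
      have "i \<otimes> j = i \<otimes> (j \<otimes> f)"
        using i j(1) fc by (metis m_assoc m_comm)
      then show ?case using i j by simp
    qed simp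
  qed
  then have "PIdl f \<subseteq> P \<or> PIdl (\<one> \<ominus> f) \<subseteq> P"
    using assms pure_ideal_cgenideal idempotent_elem_one_minus
    unfolding purely_prime_ideal_def by blast
  then show ?thesis
    using fc cgenideal_self by blast
qed

text \<open>Let \<open>f\<close> and \<open>g\<close> generate \<open>J\<close> and
  \<open>J'\<close>, so that \<open>f \<otimes> g \<otimes> e = \<zero>\<close>. By primitivity the
  idempotent \<open>f \<otimes> e\<close> is either \<open>\<zero>\<close> or \<open>e\<close>; the
  first case puts \<open>f\<close> into the annihilator of \<open>e\<close>, the second puts
  \<open>g\<close> there.\<close>

lemma cgenideal_one_minus_primitive:
  assumes pure: "\<And>I. pure_ideal I R \<Longrightarrow> \<exists>e. idempotent_elem R e \<and> I = PIdl e"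
    and prim: "primitive_idempotent R e"
  shows "purely_prime_ideal (PIdl (\<one> \<ominus> e)) R"
proof -
  have e: "idempotent_elem R e" and "e \<noteq> \<zero>"
    using prim by (auto simp: primitive_idempotent_def)
  note ec = idempotent_elem_closed [OF e]
  note mem = mem_cgenideal_one_minus_iff [OF e]
  have "PIdl (\<one> \<ominus> e) \<noteq> carrier R"
    using mem [of \<one>] ec \<open>e \<noteq> \<zero>\<close> by auto
  moreover have "J \<subseteq> PIdl (\<one> \<ominus> e) \<or> J' \<subseteq> PIdl (\<one> \<ominus> e)"
    if J: "pure_ideal J R" and J': "pure_ideal J' R" and prod: "J \<cdot> J' \<subseteq> PIdl (\<one> \<ominus> e)" for J J'
  proof -
    obtain f where f: "idempotent_elem R f" "J = PIdl f" using pure J by blast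
    obtain g where g: "idempotent_elem R g" "J' = PIdl g" using pure J' by blast
    note fc = idempotent_elem_closed [OF f(1)] and gc = idempotent_elem_closed [OF g(1)]
    have "ideal (PIdl (\<one> \<ominus> e)) R" using ec by (simp add: cgenideal_ideal)
    have fge: "f \<otimes> g \<otimes> e = \<zero>"
      using prod f(2) g(2) fc gc cgenideal_self mem ideal_prod.prod [of f J g J'] by blast
    show ?thesis
    proof (cases "f \<otimes> e = \<zero>")
      case True
      then have "f \<in> PIdl (\<one> \<ominus> e)" using mem fc by blast
      then show ?thesis
        using f(2) \<open>ideal (PIdl (\<one> \<ominus> e)) R\<close> cgenideal_minimal by blast
    next
      case False
      have "e \<otimes> (f \<otimes> e) = f \<otimes> e"
        using e ec fc by (metis idempotent_elem_def m_assoc m_comm)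
      then have "e = f \<otimes> e"
        using prim False idempotent_elem_mult [OF f(1) e] by (simp add: primitive_idempotent_def)
      then have "g \<otimes> e = f \<otimes> g \<otimes> e"
        using ec fc gc by (metis m_assoc m_comm)
      then have "g \<in> PIdl (\<one> \<ominus> e)" using mem gc fge by simp
      then show ?thesis
        using g(2) \<open>ideal (PIdl (\<one> \<ominus> e)) R\<close> cgenideal_minimal by blast
    qed
  qed
  ultimately show ?thesis
    using pure_ideal_cgenideal [OF idempotent_elem_one_minus [OF e]]
    unfolding purely_prime_ideal_def by blast
qed

text \<open>If \<open>f\<close> generates a proper pure ideal \<open>J\<close> above
  \<open>P\<close>, then \<open>\<one> \<ominus> f\<close> cannot lie in \<open>P\<close>, since
  adding \<open>f\<close> would give \<open>\<one> \<in> J\<close>. Hence \<open>f\<close> lies in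
  \<open>P\<close>.\<close>

lemma purely_prime_imp_purely_maximal:
  assumes pure: "\<And>I. pure_ideal I R \<Longrightarrow> \<exists>e. idempotent_elem R e \<and> I = PIdl e"
    and P: "purely_prime_ideal P R"
  shows "purely_maximal_ideal P R"
proof -
  have PP: "pure_ideal P R" "P \<noteq> carrier R"
    using P by (auto simp: purely_prime_ideal_def)
  have "J = P" if J: "pure_ideal J R" "J \<noteq> carrier R" "P \<subseteq> J" for J
  proof -
    obtain f where f: "idempotent_elem R f" "J = PIdl f" using pure J(1) by blast
    note fc = idempotent_elem_closed [OF f(1)]
    interpret J: ideal J R using J(1) by (simp add: pure_ideal_def)
    have fJ: "f \<in> J" using f(2) fc cgenideal_self by blast
    have "\<one> \<ominus> f \<notin> P"
    proof
      assume "\<one> \<ominus> f \<in> P"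
      then have "(\<one> \<ominus> f) \<oplus> f \<in> J" using J(3) fJ by blast
      moreover have "(\<one> \<ominus> f) \<oplus> f = \<one>"
        using fc by (simp add: minus_eq a_assoc l_neg)
      ultimately show False
        using J pure_ideal_eq_carrier_iff by simp
    qed
    then have "f \<in> P" using purely_prime_idempotent_cases [OF P f(1)] by blast
    then have "J \<subseteq> P"
      using f(2) PP(1) cgenideal_minimal by (simp add: pure_ideal_def)
    then show ?thesis using J(3) by blast
  qed
  then show ?thesis
    using PP unfolding purely_maximal_ideal_def by blast
qed

lemma purely_prime_eq_cgenideal_one_minus:
  assumes pure: "\<And>I. pure_ideal I R \<Longrightarrow> \<exists>e. idempotent_elem R e \<and> I = PIdl e"
    and P: "purely_prime_ideal P R"
  shows "\<exists>e. primitive_idempotent R e \<and> P = PIdl (\<one> \<ominus> e)"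
proof -
  have PP: "pure_ideal P R" "P \<noteq> carrier R"
    using P by (auto simp: purely_prime_ideal_def)
  obtain d where d: "idempotent_elem R d" "P = PIdl d" using pure PP(1) by blast
  define e where "e = \<one> \<ominus> d"
  have e: "idempotent_elem R e"
    using d(1) by (simp add: e_def idempotent_elem_one_minus)
  note ec = idempotent_elem_closed [OF e]
  have Pe: "P = PIdl (\<one> \<ominus> e)"
    using d by (simp add: e_def one_minus_one_minus idempotent_elem_closed)
  \<comment> \<open>In this form \<open>P\<close> is the annihilator of \<open>e\<close>.\<close>
  note mem = mem_cgenideal_one_minus_iff [OF e, folded Pe]
  have "e \<noteq> \<zero>"
    using PP mem [of \<one>] ec pure_ideal_eq_carrier_iff by auto
  moreover have "e = g"
    if g: "idempotent_elem R g" "g \<noteq> \<zero>" "e \<otimes> g = g" for g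
  proof -
    note gc = idempotent_elem_closed [OF g(1)]
    have ge: "g \<otimes> e = g" using g(3) gc ec by (simp add: m_comm)
    \<comment> \<open>A nonzero \<open>g\<close> below \<open>e\<close> is not annihilated by
      \<open>e\<close>, so \<open>\<one> \<ominus> g\<close> must be, and then
      \<open>e = e \<otimes> g = g\<close>.\<close>
    then have "g \<notin> P" using mem g(2) by simp
    then have "\<one> \<ominus> g \<in> P" using purely_prime_idempotent_cases [OF P g(1)] by blast
    then have "e \<otimes> (\<one> \<ominus> g) = \<zero>" using mem ec gc by (simp add: m_comm)
    then show "e = g"
      using g(3) ec gc mult_one_minus_eq_zero_iff by simp
  qed
  ultimately have "primitive_idempotent R e"
    using e unfolding primitive_idempotent_def by blast
  then show ?thesis using Pe by blast
qed

end

theorem lemma2p3: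
  fixes R :: "('a, 'b) ring_scheme"
  assumes "cring R"
    and "\<And>M. purely_maximal_ideal M R \<Longrightarrow> fin_gen_ideal M R"
  shows "({I. pure_ideal I R} = {PIdl\<^bsub>R\<^esub> e | e. idempotent_elem R e} \<and>
      (\<forall>P. purely_prime_ideal P R \<longrightarrow> purely_maximal_ideal P R)) \<and>
    {P. purely_prime_ideal P R} =
      {PIdl\<^bsub>R\<^esub> (\<one>\<^bsub>R\<^esub> \<ominus>\<^bsub>R\<^esub> e) | e. primitive_idempotent R e}"
proof -
  interpret cring R by fact
  have pure: "\<exists>e. idempotent_elem R e \<and> I = PIdl\<^bsub>R\<^esub> e" if "pure_ideal I R" for I
    using pure_ideal_generated_by_idempotent assms(2) that by blast
  have "{I. pure_ideal I R} = {PIdl\<^bsub>R\<^esub> e | e. idempotent_elem R e}"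
    using pure pure_ideal_cgenideal by blast
  moreover have "\<forall>P. purely_prime_ideal P R \<longrightarrow> purely_maximal_ideal P R"
    using purely_prime_imp_purely_maximal pure by blast
  moreover have "{P. purely_prime_ideal P R} =
      {PIdl\<^bsub>R\<^esub> (\<one>\<^bsub>R\<^esub> \<ominus>\<^bsub>R\<^esub> e) | e. primitive_idempotent R e}"
    using purely_prime_eq_cgenideal_one_minus [OF pure] cgenideal_one_minus_primitive [OF pure]
    by blast
  ultimately show ?thesis by blast
qed

end
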